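(* Let $R\subset S$ be a flat extension of complete local domains where $R$ is one-dimensional. If the contraction to $R$ of every nonzero ideal of $S$ is nonzero, then $I^{\mathrm{sat}}S=(IS)^{\mathrm{sat}}$ holds for every ideal $I\subset R$.
   Context: Local rings are Noetherian, and an extension of local rings is an injective local homomorphism. For an ideal $K$ of a local ring $(A,\mathfrak m_A)$, the saturation of $K$ is $K^{\mathrm{sat}}=\bigcup_{i\ge 1}(K:_A\mathfrak m_A^i)$; so $I^{\mathrm{sat}}$ is computed in $R$ and $(IS)^{\mathrm{sat}}$ in $S$. The contraction of an ideal $Q$ of $S$ is $Q\cap R$. *)

theory Defs
  imports "HOL-Algebra.Algebra" "HOL-Library.Extended_Nat"
begin

section \<open>Complete local rings and Krull dimension\<close>

locale local_ring = cring R + noetherian_ring R for R (structure) +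
  assumes ex1_maximalideal: "\<exists>!M. maximalideal M R"

definition max_ideal :: "('a, 'r) ring_scheme \<Rightarrow> 'a set" where
  "max_ideal R = (THE M. maximalideal M R)"

text \<open>The ideals of a ring form the monoid \<open>ideals_set R\<close> under the product of ideals, with unit
  \<open>carrier R\<close>; powers of ideals are powers in this monoid.\<close>

abbreviation ideal_power :: "('a, 'r) ring_scheme \<Rightarrow> 'a set \<Rightarrow> nat \<Rightarrow> 'a set" where
  "ideal_power R J n \<equiv> J [^]\<^bsub>ideals_set R\<^esub> n"

definition adic_Cauchy :: "('a, 'r) ring_scheme \<Rightarrow> 'a set \<Rightarrow> (nat \<Rightarrow> 'a) \<Rightarrow> bool" where
  "adic_Cauchy R J x \<longleftrightarrow>
     (\<forall>n. x n \<in> carrier R) \<and>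
     (\<forall>k. \<exists>N. \<forall>i\<ge>N. \<forall>j\<ge>N. x i \<ominus>\<^bsub>R\<^esub> x j \<in> ideal_power R J k)"

definition adic_limit :: "('a, 'r) ring_scheme \<Rightarrow> 'a set \<Rightarrow> (nat \<Rightarrow> 'a) \<Rightarrow> 'a \<Rightarrow> bool" where
  "adic_limit R J x l \<longleftrightarrow>
     l \<in> carrier R \<and> (\<forall>k. \<exists>N. \<forall>i\<ge>N. x i \<ominus>\<^bsub>R\<^esub> l \<in> ideal_power R J k)"

text \<open>Uniqueness of limits says that the topology is separated.\<close>

definition adic_complete :: "('a, 'r) ring_scheme \<Rightarrow> 'a set \<Rightarrow> bool" where
  "adic_complete R J \<longleftrightarrow> (\<forall>x. adic_Cauchy R J x \<longrightarrow> (\<exists>!l. adic_limit R J x l))"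

locale complete_local_domain = local_ring R + domain R for R (structure) +
  assumes complete: "adic_complete R (max_ideal R)"

definition krull_dim :: "('a, 'r) ring_scheme \<Rightarrow> enat" where
  "krull_dim R = Sup {enat n | n. \<exists>P :: nat \<Rightarrow> 'a set.
     (\<forall>i\<le>n. primeideal (P i) R) \<and> (\<forall>i<n. P i \<subset> P (Suc i))}"


section \<open>Extensions, extended and contracted ideals, saturation\<close>

text \<open>The inclusion of \<open>R\<close> into \<open>S\<close> is given as an injective homomorphism.\<close>

definition local_extension ::
  "('a, 'r) ring_scheme \<Rightarrow> ('b, 's) ring_scheme \<Rightarrow> ('a \<Rightarrow> 'b) \<Rightarrow> bool" where
  "local_extension R S h \<longleftrightarrow>
     h \<in> ring_hom R S \<and> inj_on h (carrier R) \<and> h ` max_ideal R \<subseteq> max_ideal S"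

definition ideal_extension :: "('b, 's) ring_scheme \<Rightarrow> ('a \<Rightarrow> 'b) \<Rightarrow> 'a set \<Rightarrow> 'b set" where
  "ideal_extension S h I = Idl\<^bsub>S\<^esub> (h ` I)"

definition ideal_contraction :: "('a, 'r) ring_scheme \<Rightarrow> ('a \<Rightarrow> 'b) \<Rightarrow> 'b set \<Rightarrow> 'a set" where
  "ideal_contraction R h Q = {r \<in> carrier R. h r \<in> Q}"

definition ideal_colon :: "('a, 'r) ring_scheme \<Rightarrow> 'a set \<Rightarrow> 'a set \<Rightarrow> 'a set" where
  "ideal_colon R K J = {r \<in> carrier R. \<forall>j\<in>J. r \<otimes>\<^bsub>R\<^esub> j \<in> K}"

definition saturation :: "('a, 'r) ring_scheme \<Rightarrow> 'a set \<Rightarrow> 'a set" where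
  "saturation R K = (\<Union>i\<in>{1..}. ideal_colon R K (ideal_power R (max_ideal R) i))"


section \<open>Tensor products and flatness\<close>

text \<open>The tensor product of two modules over a commutative ring \<open>R\<close> is the free abelian group on
  pairs modulo bilinearity.  Only its additive group (written multiplicatively, as \<open>Mod\<close> does)
  matters for flatness, so the \<open>R\<close>-action on it is not recorded.\<close>

definition tensor_free ::
  "('a, 'm, 'p) module_scheme \<Rightarrow> ('a, 'n, 'q) module_scheme \<Rightarrow> ('m \<times> 'n \<Rightarrow>\<^sub>0 int) monoid" where
  "tensor_free M N = free_Abelian_group (carrier M \<times> carrier N)"

definition tensor_rels :: "('a, 'r) ring_scheme \<Rightarrow> ('a, 'm, 'p) module_scheme \<Rightarrow>
    ('a, 'n, 'q) module_scheme \<Rightarrow> ('m \<times> 'n \<Rightarrow>\<^sub>0 int) set" where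
  "tensor_rels R M N =
     {frag_of (x \<oplus>\<^bsub>M\<^esub> x', y) - frag_of (x, y) - frag_of (x', y) | x x' y.
        x \<in> carrier M \<and> x' \<in> carrier M \<and> y \<in> carrier N} \<union>
     {frag_of (x, y \<oplus>\<^bsub>N\<^esub> y') - frag_of (x, y) - frag_of (x, y') | x y y'.
        x \<in> carrier M \<and> y \<in> carrier N \<and> y' \<in> carrier N} \<union>
     {frag_of (r \<odot>\<^bsub>M\<^esub> x, y) - frag_of (x, r \<odot>\<^bsub>N\<^esub> y) | r x y.
        r \<in> carrier R \<and> x \<in> carrier M \<and> y \<in> carrier N}"

definition tensor_null :: "('a, 'r) ring_scheme \<Rightarrow> ('a, 'm, 'p) module_scheme \<Rightarrow>
    ('a, 'n, 'q) module_scheme \<Rightarrow> ('m \<times> 'n \<Rightarrow>\<^sub>0 int) set" where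
  "tensor_null R M N = generate (tensor_free M N) (tensor_rels R M N)"

definition tensor_product :: "('a, 'r) ring_scheme \<Rightarrow> ('a, 'm, 'p) module_scheme \<Rightarrow>
    ('a, 'n, 'q) module_scheme \<Rightarrow> ('m \<times> 'n \<Rightarrow>\<^sub>0 int) set monoid" where
  "tensor_product R M N = tensor_free M N Mod tensor_null R M N"

definition module_hom :: "('a, 'r) ring_scheme \<Rightarrow> ('a, 'm, 'p) module_scheme \<Rightarrow>
    ('a, 'n, 'q) module_scheme \<Rightarrow> ('m \<Rightarrow> 'n) set" where
  "module_hom R M N = {f \<in> carrier M \<rightarrow> carrier N.
     (\<forall>x\<in>carrier M. \<forall>y\<in>carrier M. f (x \<oplus>\<^bsub>M\<^esub> y) = f x \<oplus>\<^bsub>N\<^esub> f y) \<and>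
     (\<forall>r\<in>carrier R. \<forall>x\<in>carrier M. f (r \<odot>\<^bsub>M\<^esub> x) = r \<odot>\<^bsub>N\<^esub> f x)}"

text \<open>For \<open>f : M \<rightarrow> M'\<close>, the map \<open>f \<otimes> id : M \<otimes> N \<rightarrow> M' \<otimes> N\<close> induced on cosets.\<close>

definition tensor_map :: "('a, 'r) ring_scheme \<Rightarrow> ('a, 'm', 'p) module_scheme \<Rightarrow>
    ('a, 'n, 'q) module_scheme \<Rightarrow> ('m \<Rightarrow> 'm') \<Rightarrow>
    ('m \<times> 'n \<Rightarrow>\<^sub>0 int) set \<Rightarrow> ('m' \<times> 'n \<Rightarrow>\<^sub>0 int) set" where
  "tensor_map R M' N f C =
     tensor_null R M' N <#>\<^bsub>tensor_free M' N\<^esub> frag_extend (\<lambda>(x, y). frag_of (f x, y)) ` C"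

lemma tensor_rels_subset:
  assumes "module R M" "module R N"
  shows "tensor_rels R M N \<subseteq> carrier (tensor_free M N)"
proof -
  interpret M: module R M by fact
  interpret N: module R N by fact
  have diff: "c - d \<in> {c. Poly_Mapping.keys c \<subseteq> carrier M \<times> carrier N}"
    if "Poly_Mapping.keys c \<subseteq> carrier M \<times> carrier N" "Poly_Mapping.keys d \<subseteq> carrier M \<times> carrier N"
    for c d :: "('c \<times> 'e) \<Rightarrow>\<^sub>0 int"
    using keys_diff[of c d] that by blast
  have diff': "Poly_Mapping.keys (c - d) \<subseteq> carrier M \<times> carrier N"
    if "Poly_Mapping.keys c \<subseteq> carrier M \<times> carrier N" "Poly_Mapping.keys d \<subseteq> carrier M \<times> carrier N"
    for c d :: "('c \<times> 'e) \<Rightarrow>\<^sub>0 int"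
    using diff[OF that] by blast
  have "c \<in> carrier (tensor_free M N)" if "c \<in> tensor_rels R M N" for c
    using that unfolding tensor_rels_def tensor_free_def carrier_free_Abelian_group_iff
    by (elim UnE CollectE exE conjE) (simp_all add: diff')
  then show ?thesis by blast
qed

lemma tensor_null_subgroup:
  assumes "module R M" "module R N"
  shows "subgroup (tensor_null R M N) (tensor_free M N)"
  unfolding tensor_null_def
  by (rule group.generate_is_subgroup[OF _ tensor_rels_subset[OF assms]]) (simp add: tensor_free_def)

lemma tensor_map_coset:
  assumes "module R M" "module R M'" "module R N" and f: "f \<in> module_hom R M M'"
  shows "tensor_map R M' N f (tensor_null R M N #>\<^bsub>tensor_free M N\<^esub> c) =
    tensor_null R M' N #>\<^bsub>tensor_free M' N\<^esub> frag_extend (\<lambda>(x, y). frag_of (f x, y)) c"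
proof -
  interpret M: module R M by fact
  interpret N: module R N by fact
  let ?F = "frag_extend (\<lambda>(x, y). frag_of (f x, y))"
  interpret K: subgroup "tensor_null R M' N" "tensor_free M' N"
    by (rule tensor_null_subgroup) fact+
  have K0: "0 \<in> tensor_null R M' N" using K.one_closed by (simp add: tensor_free_def)
  have Kadd: "x + y \<in> tensor_null R M' N"
    if "x \<in> tensor_null R M' N" "y \<in> tensor_null R M' N" for x y
    using K.m_closed[OF that] by (simp add: tensor_free_def)
  have Kminus: "- x \<in> tensor_null R M' N" if "x \<in> tensor_null R M' N" for x
    using K.m_inv_closed[OF that] K.mem_carrier[OF that] by (simp add: tensor_free_def)
  have rels: "?F x \<in> tensor_null R M' N" if "x \<in> tensor_rels R M N" for x
  proof -
    have "?F x \<in> tensor_rels R M' N"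
      using that f unfolding tensor_rels_def module_hom_def
      apply (elim UnE CollectE exE conjE)
      subgoal by (rule UnI1, rule UnI1, clarsimp simp: frag_extend_diff) blast
      subgoal by (rule UnI1, rule UnI2, clarsimp simp: frag_extend_diff) blast
      subgoal by (rule UnI2, clarsimp simp: frag_extend_diff) blast
      done
    then show ?thesis unfolding tensor_null_def by (rule generate.incl)
  qed
  have null: "?F x \<in> tensor_null R M' N" if "x \<in> tensor_null R M N" for x
    using that unfolding tensor_null_def[of R M N]
  proof (induction rule: generate.induct)
    case (inv h)
    then have "h \<in> carrier (tensor_free M N)"
      using tensor_rels_subset[OF assms(1,3)] by blast
    then have "inv\<^bsub>tensor_free M N\<^esub> h = - h" by (simp add: tensor_free_def)
    then show ?case using rels[OF inv] by (simp add: frag_extend_minus Kminus)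
  qed (simp_all add: tensor_free_def K0 rels frag_extend_add Kadd)
  have "0 \<in> tensor_null R M N"
    using generate.one[of "tensor_free M N"] by (simp add: tensor_null_def tensor_free_def)
  then have zero: "\<exists>n\<in>tensor_null R M N. ?F n = 0" by force
  have "(\<exists>k\<in>tensor_null R M' N. \<exists>n\<in>tensor_null R M N. y = k + ?F (n + c)) \<longleftrightarrow>
        (\<exists>k\<in>tensor_null R M' N. y = k + ?F c)" for y
  proof
    assume "\<exists>k\<in>tensor_null R M' N. \<exists>n\<in>tensor_null R M N. y = k + ?F (n + c)"
    then obtain k n where k: "k \<in> tensor_null R M' N" and n: "n \<in> tensor_null R M N"
      and y: "y = k + ?F (n + c)" by blast
    have "y = (k + ?F n) + ?F c" by (simp only: y frag_extend_add add.assoc)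
    with Kadd[OF k null[OF n]] show "\<exists>k\<in>tensor_null R M' N. y = k + ?F c" by blast
  next
    assume "\<exists>k\<in>tensor_null R M' N. y = k + ?F c"
    then obtain k where k: "k \<in> tensor_null R M' N" "y = k + ?F c" by blast
    obtain n where n: "n \<in> tensor_null R M N" "?F n = 0" using zero by blast
    have "y = k + ?F (n + c)" by (simp only: k(2) frag_extend_add n(2) add_0)
    with k n show "\<exists>k\<in>tensor_null R M' N. \<exists>n\<in>tensor_null R M N. y = k + ?F (n + c)"
      by blast
  qed
  then show ?thesis
    by (auto simp: tensor_map_def set_mult_def r_coset_def tensor_free_def)
qed

text \<open>\<open>N\<close> is flat if tensoring with \<open>N\<close> preserves injectivity of homomorphisms.  As a proposition
  cannot quantify over types, the type of the elements of the test modules is a parameter.  With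
  \<open>(nat \<Rightarrow> 'a) set\<close>, where \<open>'a\<close> is the type of the elements of \<open>R\<close>, every finitely generated
  \<open>R\<close>-module has an isomorphic copy among the test modules, namely the cosets of a submodule of
  some \<open>R ^ n\<close>.  That suffices for flatness with respect to all modules: that an element of
  \<open>M \<otimes> N\<close> is killed in \<open>M' \<otimes> N\<close> involves only finitely many elements of \<open>M\<close> and \<open>M'\<close>.\<close>

definition flat_wrt :: "'m itself \<Rightarrow> ('a, 'r) ring_scheme \<Rightarrow> ('a, 'n, 'q) module_scheme \<Rightarrow> bool" where
  "flat_wrt _ R N \<longleftrightarrow> module R N \<and>
     (\<forall>(M :: ('a, 'm) module) (M' :: ('a, 'm) module) f.
        module R M \<longrightarrow> module R M' \<longrightarrow> f \<in> module_hom R M M' \<longrightarrow> inj_on f (carrier M) \<longrightarrow>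
        inj_on (tensor_map R M' N f) (carrier (tensor_product R M N)))"

definition flat :: "('a, 'r) ring_scheme \<Rightarrow> ('a, 'n, 'q) module_scheme \<Rightarrow> bool" where
  "flat R N \<longleftrightarrow> flat_wrt TYPE((nat \<Rightarrow> 'a) set) R N"

definition restrict_scalars :: "('b, 's) ring_scheme \<Rightarrow> ('a \<Rightarrow> 'b) \<Rightarrow> ('a, 'b) module" where
  "restrict_scalars S h =
     \<lparr>carrier = carrier S, monoid.mult = monoid.mult S, one = one S,
      ring.zero = ring.zero S, ring.add = ring.add S,
      smult = (\<lambda>r s. h r \<otimes>\<^bsub>S\<^esub> s)\<rparr>"

definition flat_extension ::
  "('a, 'r) ring_scheme \<Rightarrow> ('b, 's) ring_scheme \<Rightarrow> ('a \<Rightarrow> 'b) \<Rightarrow> bool" where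
  "flat_extension R S h \<longleftrightarrow> local_extension R S h \<and> flat R (restrict_scalars S h)"

end

theory Submission
  imports Defs
begin

text \<open>Write \<open>m\<close> and \<open>n\<close> for the maximal ideals of \<open>R\<close> and \<open>S\<close>.  For \<open>I = 0\<close> both sides vanish,
  because \<open>R\<close> and \<open>S\<close> are domains with nonzero maximal ideals.  For \<open>I \<noteq> 0\<close> the only prime of the
  one-dimensional domain \<open>R\<close> that can contain \<open>I\<close> is \<open>m\<close>, so \<open>I\<close> contains a power of \<open>m\<close>
  (\<open>ideal_power_subset_if_all_primes_contain\<close>) and its saturation is \<open>R\<close>.  What has to be seen is
  that the saturation of \<open>I S\<close> is \<open>S\<close>, in other words that \<open>I S\<close> contains a power of \<open>n\<close>.

  Choose a nonzero \<open>x \<in> I \<inter> m\<close>.  The contraction of a nonzero ideal \<open>Q\<close> of \<open>S\<close> is nonzero, so it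
  contains a power of \<open>m\<close>, and therefore \<open>Q\<close> contains a power of \<open>x\<close>.  This reduces the claim
  to a fact about a Noetherian local domain \<open>S\<close>: if every nonzero ideal contains a power of a fixed
  \<open>x \<noteq> 0\<close>, then \<open>n\<^sup>e \<subseteq> x S\<close> for some \<open>e\<close> (\<open>max_ideal_power_subset_PIdl\<close>).  Conceptually, all
  nonzero primes of \<open>S\<close> contain \<open>x\<close>, so \<open>S\<close> has dimension at most one by Krull's principal ideal
  theorem and prime avoidance.  The proof merges these two ingredients into one argument.

  Suppose that \<open>x S\<close> contains no power of \<open>n\<close>.  Prime avoidance yields \<open>y \<in> n\<close> that is a
  nonzerodivisor modulo \<open>x S\<close>, and then modulo every \<open>x\<^sup>k S\<close>, up to elements killed by a
  power of \<open>n\<close> (\<open>exists_nearly_regular_element\<close>, \<open>near_regularity_mod_power\<close>).  Some power of \<open>x\<close>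
  is a multiple of \<open>y\<close>, say \<open>x\<^sup>k = b y\<close>; cancelling \<open>y\<close> in \<open>y b \<in> x\<^sup>k S\<close> gives
  \<open>n\<^sup>s b \<subseteq> b y S\<close>, so \<open>n\<^sup>s \<subseteq> y S\<close>.  Now \<open>S / y S\<close> is Artinian
  (\<open>descending_chain_stabilises\<close>), and Krull's argument with the decreasing ideals
  \<open>(x\<^sup>j S : y\<^sup>\<infinity>)\<close> and the Nakayama lemma shows \<open>y\<^sup>i \<in> x S\<close> for some \<open>i\<close>
  (\<open>pow_mem_PIdl_if_max_ideal_power_subset_PIdl\<close>).  Hence \<open>n\<^sup>s\<^sup>i \<subseteq> y\<^sup>i S \<subseteq> x S\<close> after all.\<close>

section \<open>Ideals and their powers\<close>

lemma (in cring) ideal_if_closed: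
  assumes "I \<subseteq> carrier R" "\<zero> \<in> I"
    and add: "\<And>x y. x \<in> I \<Longrightarrow> y \<in> I \<Longrightarrow> x \<oplus> y \<in> I"
    and mult: "\<And>r x. r \<in> carrier R \<Longrightarrow> x \<in> I \<Longrightarrow> r \<otimes> x \<in> I"
  shows "ideal I R"
proof (rule idealI)
  show "subgroup I (add_monoid R)"
  proof (rule add.subgroupI)
    fix a assume "a \<in> I"
    moreover from this have "a \<in> carrier R" using assms(1) by blast
    ultimately show "\<ominus> a \<in> I" using mult[of "\<ominus> \<one>" a] by (simp add: l_minus)
  qed (use assms in auto)
  show "x \<otimes> a \<in> I" "a \<otimes> x \<in> I" if "a \<in> I" "x \<in> carrier R" for a x
    using mult[OF that(2,1)] m_comm[of a x] that assms(1) by auto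
qed (rule ring_axioms)

lemma mem_ideal_colon_singleton [simp]:
  "r \<in> ideal_colon R K {t} \<longleftrightarrow> r \<in> carrier R \<and> r \<otimes>\<^bsub>R\<^esub> t \<in> K"
  by (simp add: ideal_colon_def)

lemma (in cring) ideal_colon_ideal:
  assumes "ideal K R" "J \<subseteq> carrier R"
  shows "ideal (ideal_colon R K J) R"
proof -
  interpret K: ideal K R by fact
  from assms(2) show ?thesis
    unfolding ideal_colon_def
    by (intro ideal_if_closed) (auto simp: l_distr m_assoc subset_iff K.I_l_closed K.a_closed K.zero_closed)
qed

lemma (in cring) ideal_power_0: "ideal_power R J 0 = carrier R"
  by (simp add: ideals_set_def)

lemma (in cring) ideal_power_Suc: "ideal_power R J (Suc n) = ideal_prod R (ideal_power R J n) J"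
  by (simp add: ideals_set_def)

lemma (in cring) ideal_power_ideal: "ideal J R \<Longrightarrow> ideal (ideal_power R J n) R"
  by (induction n) (simp_all only: ideal_power_0 ideal_power_Suc oneideal ideal_prod_is_ideal)

lemma (in cring) ideal_power_add:
  assumes "ideal J R"
  shows "ideal_power R J (m + n) = ideal_prod R (ideal_power R J m) (ideal_power R J n)"
proof -
  interpret M: comm_monoid "ideals_set R" by (rule ideals_set_is_comm_monoid)
  show ?thesis
    using M.nat_pow_mult[of J m n] assms by (simp add: ideals_set_def)
qed

lemma (in cring) ideal_prod_subset:
  assumes "ideal K R" and "\<And>i j. i \<in> I \<Longrightarrow> j \<in> J \<Longrightarrow> i \<otimes> j \<in> K"
  shows "ideal_prod R I J \<subseteq> K"
proof
  interpret K: ideal K R by fact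
  fix s assume "s \<in> ideal_prod R I J"
  then show "s \<in> K"
    by (induction rule: ideal_prod.induct) (auto intro: assms(2) K.a_closed)
qed

lemma (in cring) pow_mem_ideal_power:
  assumes "x \<in> J" "ideal J R"
  shows "x [^] n \<in> ideal_power R J n"
proof (induction n)
  case (Suc n)
  then show ?case
    using assms(1) ideal_prod.prod unfolding ideal_power_Suc by fastforce
next
  case 0
  show ?case unfolding ideal_power_0 by simp
qed

lemma (in cring) mem_PIdl_iff: "z \<in> PIdl a \<longleftrightarrow> (\<exists>c\<in>carrier R. z = c \<otimes> a)"
  by (auto simp: cgenideal_def)

lemma (in cring) mem_add_PIdl_iff:
  "t \<in> I <+> PIdl a \<longleftrightarrow> (\<exists>i\<in>I. \<exists>s\<in>carrier R. t = i \<oplus> s \<otimes> a)"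
  by (auto simp: set_add_def' cgenideal_def)

lemma (in cring) add_PIdl_ideal:
  "ideal I R \<Longrightarrow> a \<in> carrier R \<Longrightarrow> ideal (I <+> PIdl a) R"
  by (simp add: add_ideals cgenideal_ideal)

lemma (in cring) subset_add_PIdl:
  assumes "ideal I R" "a \<in> carrier R"
  shows "I \<subseteq> I <+> PIdl a"
proof
  interpret I: ideal I R by fact
  fix i assume "i \<in> I"
  moreover from this have "i = i \<oplus> \<zero> \<otimes> a" using I.Icarr assms(2) by simp
  ultimately show "i \<in> I <+> PIdl a" unfolding mem_add_PIdl_iff by blast
qed

lemma (in cring) mult_mem_add_PIdl:
  assumes "ideal I R" "a \<in> carrier R" "s \<in> carrier R"
  shows "s \<otimes> a \<in> I <+> PIdl a"
proof -
  interpret I: ideal I R by fact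
  have "s \<otimes> a = \<zero> \<oplus> s \<otimes> a" using assms(2,3) by simp
  then show ?thesis unfolding mem_add_PIdl_iff using I.zero_closed assms(3) by blast
qed

lemma (in cring) self_mem_add_PIdl:
  "ideal I R \<Longrightarrow> a \<in> carrier R \<Longrightarrow> a \<in> I <+> PIdl a"
  using mult_mem_add_PIdl[of I a \<one>] by simp

lemma (in ideal) diff_closed: "x \<in> I \<Longrightarrow> y \<in> I \<Longrightarrow> x \<ominus> y \<in> I"
  by (simp add: a_minus_def a_closed a_inv_closed)

lemma (in domain) nat_pow_nonzero:
  fixes n :: nat
  shows "a \<in> carrier R \<Longrightarrow> a \<noteq> \<zero> \<Longrightarrow> a [^] n \<noteq> \<zero>"
  by (induction n) (auto dest: integral)

section \<open>Noetherian rings\<close>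

text \<open>The union of a nonempty chain of ideals of a Noetherian ring is a member of the chain, so
  Zorn's lemma applies to any nonempty family of ideals.\<close>

lemma (in noetherian_ring) exists_maximal_ideal_among:
  assumes "\<A> \<noteq> {}" and "\<And>I. I \<in> \<A> \<Longrightarrow> ideal I R"
  shows "\<exists>M\<in>\<A>. \<forall>I\<in>\<A>. M \<subseteq> I \<longrightarrow> I = M"
proof (rule subset_Zorn_nonempty[OF assms(1)])
  fix C assume "C \<noteq> {}" and C: "subset.chain \<A> C"
  have "subset.chain {I. ideal I R} C"
    using C assms(2) unfolding pred_on.chain_def by blast
  from ideal_chain_is_trivial[OF \<open>C \<noteq> {}\<close> this] show "\<Union>C \<in> \<A>"
    using C unfolding pred_on.chain_def by blast
qed

lemma (in noetherian_ring) noetherian_induct [consumes 1, case_names step]: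
  assumes "ideal I R"
    and step: "\<And>I. ideal I R \<Longrightarrow> (\<And>J. ideal J R \<Longrightarrow> I \<subset> J \<Longrightarrow> P J) \<Longrightarrow> P I"
  shows "P I"
proof (rule ccontr)
  assume "\<not> P I"
  then have "{J. ideal J R \<and> \<not> P J} \<noteq> {}" using assms(1) by blast
  from exists_maximal_ideal_among[OF this] obtain M
    where M: "ideal M R" "\<not> P M" and max: "\<And>J. ideal J R \<Longrightarrow> \<not> P J \<Longrightarrow> M \<subseteq> J \<Longrightarrow> J = M"
    by auto
  from step[OF M(1)] max have "P M" by blast
  with M(2) show False by contradiction
qed

locale noetherian_cring = cring + noetherian_ring

sublocale local_ring \<subseteq> noetherian_cring ..

text \<open>By Noetherian induction: if \<open>I\<close> is proper and not prime, say \<open>a b \<in> I\<close> with \<open>a, b \<notin> I\<close>,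
  then powers of \<open>N\<close> lie in the larger ideals \<open>I + (a)\<close> and \<open>I + (b)\<close>, and the product of these
  two ideals lies in \<open>I\<close>.\<close>

lemma (in noetherian_cring) ideal_power_subset_if_all_primes_contain:
  assumes "ideal I R" "ideal N R" "\<And>P. primeideal P R \<Longrightarrow> I \<subseteq> P \<Longrightarrow> N \<subseteq> P"
  shows "\<exists>e. ideal_power R N e \<subseteq> I"
  using assms(1,3)
proof (induction I rule: noetherian_induct)
  case (step I)
  interpret I: ideal I R by fact
  consider "I = carrier R" | "primeideal I R"
    | a b where "a \<in> carrier R" "b \<in> carrier R" "a \<otimes> b \<in> I" "a \<notin> I" "b \<notin> I"
    using I.primeidealCD[OF cring_axioms] by blast
  then show ?case
  proof cases
    case 1
    then have "ideal_power R N 0 \<subseteq> I" unfolding ideal_power_0 by simp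
    then show ?thesis by blast
  next
    case 2
    then have "N \<subseteq> I" using step.prems by blast
    moreover have "ideal_power R N (Suc 0) \<subseteq> N"
      unfolding ideal_power_Suc ideal_power_0 using ideal_prod_inter[OF oneideal assms(2)] by blast
    ultimately show ?thesis by blast
  next
    case 3
    have power: "\<exists>e. ideal_power R N e \<subseteq> I <+>\<^bsub>R\<^esub> PIdl c" if c: "c \<in> carrier R" "c \<notin> I" for c
    proof (rule step.IH)
      show "ideal (I <+>\<^bsub>R\<^esub> PIdl c) R" using step.hyps c(1) by (rule add_PIdl_ideal)
      have sub: "I \<subseteq> I <+>\<^bsub>R\<^esub> PIdl c" using step.hyps c(1) by (rule subset_add_PIdl)
      moreover have "c \<in> I <+>\<^bsub>R\<^esub> PIdl c" using step.hyps c(1) by (rule self_mem_add_PIdl)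
      ultimately show "I \<subset> I <+>\<^bsub>R\<^esub> PIdl c" using c(2) by blast
      show "N \<subseteq> P" if "primeideal P R" "I <+>\<^bsub>R\<^esub> PIdl c \<subseteq> P" for P
        using step.prems that sub by blast
    qed
    obtain e where e: "ideal_power R N e \<subseteq> I <+>\<^bsub>R\<^esub> PIdl a" using power 3 by blast
    obtain f where f: "ideal_power R N f \<subseteq> I <+>\<^bsub>R\<^esub> PIdl b" using power 3 by blast
    have "ideal_power R N (e + f) \<subseteq> I"
      unfolding ideal_power_add[OF assms(2)]
    proof (rule ideal_prod_subset[OF step.hyps])
      fix u v assume "u \<in> ideal_power R N e" "v \<in> ideal_power R N f"
      with e f have "u \<in> I <+>\<^bsub>R\<^esub> PIdl a" "v \<in> I <+>\<^bsub>R\<^esub> PIdl b" by auto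
      then obtain i j s t where i: "i \<in> I" and j: "j \<in> I" and s: "s \<in> carrier R" and t: "t \<in> carrier R"
        and uv: "u = i \<oplus> s \<otimes> a" "v = j \<oplus> t \<otimes> b"
        unfolding mem_add_PIdl_iff by blast
      have c: "i \<in> carrier R" "j \<in> carrier R" using i j by (simp_all add: I.Icarr)
      have "u \<otimes> v = (j \<oplus> t \<otimes> b) \<otimes> i \<oplus> (s \<otimes> a) \<otimes> j \<oplus> (s \<otimes> t) \<otimes> (a \<otimes> b)"
        unfolding uv using c s t 3(1,2) by algebra
      also have "\<dots> \<in> I"
        using c s t 3(1,2) by (intro I.a_closed I.I_l_closed i j 3(3)) simp_all
      finally show "u \<otimes> v \<in> I" .
    qed
    then show ?thesis by blast
  qed
qed

section \<open>Division up to torsion\<close>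

lemma (in cring) exists_common_elem_not_in_prime:
  assumes "primeideal P R" "finite \<I>"
    and "\<And>I. I \<in> \<I> \<Longrightarrow> ideal I R \<and> \<not> I \<subseteq> P"
  shows "\<exists>z\<in>carrier R - P. \<forall>I\<in>\<I>. z \<in> I"
  using assms(2,3)
proof (induction rule: finite_induct)
  case empty
  interpret P: primeideal P R by fact
  show ?case using P.I_notcarr P.Icarr by blast
next
  case (insert I \<I>)
  interpret P: primeideal P R by fact
  interpret I: ideal I R using insert.prems by simp
  obtain z where z: "z \<in> carrier R - P" "\<forall>K\<in>\<I>. z \<in> K" using insert by blast
  obtain w where w: "w \<in> I" "w \<notin> P" using insert.prems by blast
  have wc: "w \<in> carrier R" using w(1) I.Icarr by blast
  have "z \<otimes> w \<in> carrier R - P" using P.I_prime z w wc by blast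
  moreover have "z \<otimes> w \<in> I" using I.I_l_closed z w by blast
  moreover have "z \<otimes> w \<in> K" if "K \<in> \<I>" for K
  proof -
    have "ideal K R" using insert.prems that by simp
    moreover have "z \<in> K" using that z(2) by simp
    ultimately show ?thesis using wc by (rule ideal.I_r_closed)
  qed
  ultimately show ?case by blast
qed

text \<open>The primes are added one at a time.  If the element \<open>y\<close> found so far falls into the new prime
  \<open>P\<close>, it is corrected by some \<open>z \<in> J\<close> outside \<open>P\<close> that belongs to all the old primes not
  contained in \<open>P\<close>; the old primes contained in \<open>P\<close> are avoided as soon as \<open>P\<close> is.\<close>

lemma (in cring) prime_avoidance:
  assumes "ideal J R" "finite \<F>"
    and "\<And>P. P \<in> \<F> \<Longrightarrow> primeideal P R \<and> \<not> J \<subseteq> P"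
  shows "\<exists>y\<in>J. \<forall>P\<in>\<F>. y \<notin> P"
  using assms(2,3)
proof (induction rule: finite_induct)
  case empty
  then show ?case using additive_subgroup.zero_closed ideal.axioms(1)[OF assms(1)] by blast
next
  case (insert P \<F>)
  interpret J: ideal J R by fact
  interpret P: primeideal P R using insert.prems by simp
  obtain y where y: "y \<in> J" "\<forall>K\<in>\<F>. y \<notin> K" using insert.IH insert.prems by auto
  show ?case
  proof (cases "y \<in> P")
    case True
    \<comment> \<open>An element outside \<open>P\<close> cannot belong to an old prime contained in \<open>P\<close>, so \<open>z\<close> is chosen
      in the remaining ones.\<close>
    let ?G = "{K \<in> \<F>. \<not> K \<subseteq> P}"
    have "\<exists>z\<in>carrier R - P. \<forall>I\<in>insert J ?G. z \<in> I"
    proof (rule exists_common_elem_not_in_prime)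
      show "primeideal P R" by (rule P.primeideal)
      show "finite (insert J ?G)" using insert.hyps by simp
      show "ideal I R \<and> \<not> I \<subseteq> P" if "I \<in> insert J ?G" for I
        using that insert.prems assms(1) primeideal.axioms(1) by blast
    qed
    then obtain z where "z \<in> carrier R - P" and mem: "\<forall>I\<in>insert J ?G. z \<in> I"
      by (rule bexE)
    then have z: "z \<in> carrier R" "z \<notin> P" "z \<in> J" by simp_all
    have yc: "y \<in> carrier R" using y(1) by (rule J.Icarr)
    have "y \<oplus> z \<notin> P"
    proof
      assume "y \<oplus> z \<in> P"
      then have "(y \<oplus> z) \<ominus> y \<in> P" using True P.a_closed P.a_inv_closed by (simp add: a_minus_def)
      moreover have "(y \<oplus> z) \<ominus> y = z" using yc z(1) by algebra
      ultimately show False using z(2) by simp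
    qed
    moreover have "y \<oplus> z \<notin> K" if K: "K \<in> \<F>" for K
    proof (cases "K \<subseteq> P")
      case False
      interpret K: ideal K R using K insert.prems primeideal.axioms(1) by auto
      show ?thesis
      proof
        assume "y \<oplus> z \<in> K"
        moreover have "z \<in> K" using K False mem by simp
        ultimately have "(y \<oplus> z) \<ominus> z \<in> K" using K.a_closed K.a_inv_closed by (simp add: a_minus_def)
        moreover have "(y \<oplus> z) \<ominus> z = y" using yc z(1) by algebra
        ultimately show False using y(2) K by simp
      qed
    next
      case True
      with \<open>y \<oplus> z \<notin> P\<close> show ?thesis by (rule contra_subsetD[rotated])
    qed
    ultimately show ?thesis using J.a_closed[OF y(1) z(3)] by (intro bexI[of _ "y \<oplus> z"]) auto
  next
    case False
    with y show ?thesis by (intro bexI[of _ y]) simp_all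
  qed
qed

text \<open>A substitute for the associated primes of \<open>J\<close> other than those containing \<open>N\<close>: an element
  outside all of the primes in \<open>\<F>\<close> can be cancelled modulo \<open>J\<close> at the price of a fixed power of
  \<open>N\<close>.  Noetherian induction builds a prime filtration.  A maximal ideal among the colon ideals
  \<open>(J : a)\<close> with \<open>a \<notin> J\<close> is a prime \<open>P\<close>, and the claim for \<open>J\<close> follows from that for
  \<open>J + (a)\<close>: either \<open>P\<close> joins the list, or \<open>N\<close> kills \<open>a\<close> modulo \<open>J\<close>, which costs one
  more factor from \<open>N\<close>.  That \<open>e\<close> depends on neither \<open>y\<close> nor \<open>t\<close> is what later allows
  passing from \<open>x\<close> to its powers.\<close>

lemma (in noetherian_cring) finite_primes_control_division:
  assumes "ideal J R" "ideal N R"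
  shows "\<exists>\<F> e. finite \<F> \<and> (\<forall>P\<in>\<F>. primeideal P R \<and> \<not> N \<subseteq> P) \<and>
    (\<forall>y\<in>carrier R. (\<forall>P\<in>\<F>. y \<notin> P) \<longrightarrow>
      (\<forall>t\<in>carrier R. y \<otimes> t \<in> J \<longrightarrow> ideal_power R N e \<subseteq> ideal_colon R J {t}))"
  using assms(1)
proof (induction J rule: noetherian_induct)
  case (step J)
  interpret J: ideal J R by fact
  interpret N: ideal N R by fact
  show ?case
  proof (cases "J = carrier R")
    case True
    then have "ideal_power R N 0 \<subseteq> ideal_colon R J {t}" if "t \<in> carrier R" for t
      unfolding ideal_power_0 using that by auto
    then show ?thesis by (intro exI[of _ "{}"] exI[of _ 0]) blast
  next
    case False
    \<comment> \<open>The ideals \<open>(J : a)\<close> are the annihilators of the nonzero elements of \<open>R / J\<close>.\<close>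
    let ?\<A> = "(\<lambda>a. ideal_colon R J {a}) ` (carrier R - J)"
    have "?\<A> \<noteq> {}" using False J.Icarr by blast
    moreover have "ideal I R" if "I \<in> ?\<A>" for I
      using that step.hyps by (auto intro: ideal_colon_ideal)
    ultimately have "\<exists>M\<in>?\<A>. \<forall>I\<in>?\<A>. M \<subseteq> I \<longrightarrow> I = M"
      by (rule exists_maximal_ideal_among)
    then obtain a where a: "a \<in> carrier R" "a \<notin> J"
      and max: "\<And>b. b \<in> carrier R - J \<Longrightarrow> ideal_colon R J {a} \<subseteq> ideal_colon R J {b} \<Longrightarrow>
        ideal_colon R J {b} = ideal_colon R J {a}"
      by auto
    define P where "P = ideal_colon R J {a}"
    have memP: "r \<in> P \<longleftrightarrow> r \<in> carrier R \<and> r \<otimes> a \<in> J" for r by (simp add: P_def)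
    have P: "primeideal P R"
    proof (rule primeidealI)
      show "ideal P R" unfolding P_def using step.hyps a(1) by (intro ideal_colon_ideal) auto
      show "carrier R \<noteq> P" using memP[of \<one>] a by auto
      fix u v assume uv: "u \<in> carrier R" "v \<in> carrier R" "u \<otimes> v \<in> P"
      show "u \<in> P \<or> v \<in> P"
      proof (rule disjCI)
        assume "v \<notin> P"
        then have va: "v \<otimes> a \<in> carrier R - J" using uv(2) a(1) by (simp add: memP)
        have "ideal_colon R J {a} \<subseteq> ideal_colon R J {v \<otimes> a}"
          using uv(2) a(1) J.I_l_closed[of _ v] by (auto simp: m_lcomm[of _ v a])
        from max[OF va this] have "P = ideal_colon R J {v \<otimes> a}" by (simp add: P_def)
        moreover have "u \<otimes> (v \<otimes> a) \<in> J" using uv a(1) by (simp add: memP m_assoc)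
        ultimately show "u \<in> P" using uv(1) by simp
      qed
    qed (rule cring_axioms)
    define J' where "J' = J <+>\<^bsub>R\<^esub> PIdl a"
    have J': "ideal J' R" "J \<subseteq> J'" "a \<in> J'"
      unfolding J'_def using step.hyps a(1)
      by (simp_all add: add_PIdl_ideal subset_add_PIdl self_mem_add_PIdl)
    then have "J \<subset> J'" using a(2) by blast
    from step.IH[OF J'(1) this] obtain \<F> e where \<F>: "finite \<F>"
      "\<And>K. K \<in> \<F> \<Longrightarrow> primeideal K R \<and> \<not> N \<subseteq> K"
      and div: "\<And>y t. y \<in> carrier R \<Longrightarrow> (\<And>K. K \<in> \<F> \<Longrightarrow> y \<notin> K) \<Longrightarrow> t \<in> carrier R \<Longrightarrow>
        y \<otimes> t \<in> J' \<Longrightarrow> ideal_power R N e \<subseteq> ideal_colon R J' {t}"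
      by metis
    define \<G> where "\<G> = (if N \<subseteq> P then \<F> else insert P \<F>)"
    have "ideal_power R N (Suc e) \<subseteq> ideal_colon R J {t}"
      if y: "y \<in> carrier R" "\<And>K. K \<in> \<G> \<Longrightarrow> y \<notin> K" and t: "t \<in> carrier R" "y \<otimes> t \<in> J" for y t
      unfolding ideal_power_Suc
    proof (rule ideal_prod_subset)
      show "ideal (ideal_colon R J {t}) R" using step.hyps t(1) by (intro ideal_colon_ideal) auto
      fix z u assume z: "z \<in> ideal_power R N e" and u: "u \<in> N"
      have zc: "z \<in> carrier R"
        using z ideal_power_ideal[OF assms(2)] by (rule ideal.Icarr[rotated])
      have uc: "u \<in> carrier R" using u by (rule N.Icarr)
      have "\<And>K. K \<in> \<F> \<Longrightarrow> y \<notin> K" using y(2) by (simp add: \<G>_def split: if_splits)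
      moreover have "y \<otimes> t \<in> J'" using t(2) J'(2) by blast
      ultimately have "ideal_power R N e \<subseteq> ideal_colon R J' {t}" using y(1) t(1) div by blast
      then have "z \<otimes> t \<in> J'" using z by auto
      then obtain j s where j: "j \<in> J" and s: "s \<in> carrier R" and zt: "z \<otimes> t = j \<oplus> s \<otimes> a"
        unfolding J'_def mem_add_PIdl_iff by blast
      have jc: "j \<in> carrier R" using j by (rule J.Icarr)
      \<comment> \<open>Here the two kinds of \<open>P\<close> differ: if \<open>N \<subseteq> P\<close>, the extra factor \<open>u \<in> N\<close> kills \<open>a\<close>
        modulo \<open>J\<close>; otherwise \<open>y \<notin> P\<close> forces \<open>s \<in> P\<close>.\<close>
      have usaJ: "u \<otimes> (s \<otimes> a) \<in> J"
      proof (cases "N \<subseteq> P")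
        case True
        then have "u \<otimes> a \<in> J" using u memP by blast
        then have "s \<otimes> (u \<otimes> a) \<in> J" using s by (rule J.I_l_closed)
        then show ?thesis using s uc a(1) by (simp add: m_lcomm)
      next
        case False
        then have "y \<notin> P" using y(2) by (simp add: \<G>_def)
        have "(y \<otimes> s) \<otimes> a = z \<otimes> (y \<otimes> t) \<ominus> y \<otimes> j"
        proof -
          have "z \<otimes> (y \<otimes> t) = y \<otimes> (z \<otimes> t)" using zc y(1) t(1) by (simp add: m_lcomm)
          also have "\<dots> = y \<otimes> j \<oplus> (y \<otimes> s) \<otimes> a"
            using y(1) jc s a(1) by (simp add: zt r_distr m_assoc)
          finally show ?thesis using y(1) jc s a(1) by algebra
        qed
        also have "\<dots> \<in> J"
          using J.I_l_closed[OF t(2) zc] J.I_l_closed[OF j y(1)] by (rule J.diff_closed)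
        finally have "y \<otimes> s \<in> P" using y(1) s by (simp add: memP)
        then have "s \<in> P" using primeideal.I_prime[OF P y(1) s] \<open>y \<notin> P\<close> by blast
        then show ?thesis using uc by (simp add: memP J.I_l_closed)
      qed
      have "(z \<otimes> u) \<otimes> t = u \<otimes> (z \<otimes> t)" using zc uc t(1) by (simp add: m_ac)
      also have "\<dots> = u \<otimes> j \<oplus> u \<otimes> (s \<otimes> a)" using uc jc s a(1) by (simp add: zt r_distr)
      also have "\<dots> \<in> J" using J.I_l_closed[OF j uc] usaJ by (rule J.a_closed)
      finally show "z \<otimes> u \<in> ideal_colon R J {t}" using zc uc by simp
    qed
    moreover have "finite \<G>" "\<And>K. K \<in> \<G> \<Longrightarrow> primeideal K R \<and> \<not> N \<subseteq> K"
      using \<F> P by (auto simp: \<G>_def split: if_splits)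
    ultimately show ?thesis by (intro exI[of _ \<G>] exI[of _ "Suc e"]) blast
  qed
qed

lemma (in noetherian_cring) exists_nearly_regular_element:
  assumes "ideal J R" "ideal N R"
  shows "\<exists>y\<in>N. \<exists>e. \<forall>t\<in>carrier R. y \<otimes> t \<in> J \<longrightarrow> ideal_power R N e \<subseteq> ideal_colon R J {t}"
proof -
  obtain \<F> e where \<F>: "finite \<F>" "\<And>P. P \<in> \<F> \<Longrightarrow> primeideal P R \<and> \<not> N \<subseteq> P"
    and div: "\<And>y t. y \<in> carrier R \<Longrightarrow> \<forall>P\<in>\<F>. y \<notin> P \<Longrightarrow> t \<in> carrier R \<Longrightarrow>
      y \<otimes> t \<in> J \<Longrightarrow> ideal_power R N e \<subseteq> ideal_colon R J {t}"
    using finite_primes_control_division[OF assms] by metis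
  from prime_avoidance[OF assms(2) \<F>] obtain y where "y \<in> N" "\<forall>P\<in>\<F>. y \<notin> P" by blast
  with div ideal.Icarr[OF assms(2)] show ?thesis by blast
qed

section \<open>Artinian quotients and the Nakayama lemma\<close>

text \<open>This says that \<open>R / C\<close> is Artinian.  By Noetherian induction on \<open>C\<close>: as a power of \<open>N\<close> lies in
  \<open>C\<close>, there is \<open>z \<notin> C\<close> with \<open>N z \<subseteq> C\<close>.  Then \<open>(C + (z)) / C\<close> is a simple module, the chain
  \<open>A j + (z)\<close> stabilises by induction, and two members of a chain of ideals above \<open>C\<close> agree if
  they have the same sum with \<open>(z)\<close> and both or neither of them contain \<open>z\<close>.\<close>

lemma (in noetherian_cring) descending_chain_stabilises:
  fixes A :: "nat \<Rightarrow> 'a set"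
  assumes "ideal C R" and N: "maximalideal N R" and "ideal_power R N s \<subseteq> C"
    and "\<And>j. ideal (A j) R" "\<And>j. C \<subseteq> A j" and "antimono A"
  shows "\<exists>k. \<forall>j\<ge>k. A j = A k"
  using assms(1,3-)
proof (induction C arbitrary: A rule: noetherian_induct)
  case (step C)
  interpret C: ideal C R by fact
  interpret N: maximalideal N R by fact
  have A: "ideal (A j) R" for j by (rule step.prems)
  show ?case
  proof (cases "C = carrier R")
    case True
    then have "A j = carrier R" for j
      using step.prems(3)[of j] ideal.Icarr[OF A[of j]] by blast
    then show ?thesis by blast
  next
    case False
    \<comment> \<open>Any element of the last power of \<open>N\<close> not contained in \<open>C\<close> serves as \<open>z\<close>.\<close>
    define e where "e = (LEAST e. ideal_power R N e \<subseteq> C)"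
    have e: "ideal_power R N e \<subseteq> C" unfolding e_def by (rule LeastI, rule step.prems(1))
    have "e \<noteq> 0"
    proof
      assume "e = 0"
      with e have "carrier R \<subseteq> C" by (simp only: ideal_power_0)
      with False C.Icarr show False by blast
    qed
    then obtain d where d: "e = Suc d" using not0_implies_Suc by blast
    have "\<not> ideal_power R N d \<subseteq> C"
      using not_less_Least[of d "\<lambda>e. ideal_power R N e \<subseteq> C"] d by (simp add: e_def)
    then obtain z where z: "z \<in> ideal_power R N d" "z \<notin> C" by blast
    have zc: "z \<in> carrier R"
      using z(1) ideal_power_ideal[OF N.is_ideal] by (rule ideal.Icarr[rotated])
    have Nz: "r \<otimes> z \<in> C" if "r \<in> N" for r
    proof -
      have "z \<otimes> r \<in> ideal_power R N e"
        unfolding d ideal_power_Suc using z(1) that by (rule ideal_prod.prod)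
      then show ?thesis using e zc that N.Icarr m_comm by auto
    qed
    have "\<exists>k. \<forall>j\<ge>k. A j <+>\<^bsub>R\<^esub> PIdl z = A k <+>\<^bsub>R\<^esub> PIdl z"
    proof (rule step.IH)
      show "ideal (C <+> PIdl z) R" "C \<subset> C <+> PIdl z"
        using step.hyps zc z(2) subset_add_PIdl self_mem_add_PIdl by (auto simp: add_PIdl_ideal)
      then show "ideal_power R N s \<subseteq> C <+> PIdl z" using step.prems(1) by blast
      show "ideal (A j <+>\<^bsub>R\<^esub> PIdl z) R" for j using A zc by (rule add_PIdl_ideal)
      show "C <+> PIdl z \<subseteq> A j <+>\<^bsub>R\<^esub> PIdl z" for j
        using step.prems(3)[of j] by (force simp: mem_add_PIdl_iff)
      show "antimono (\<lambda>j. A j <+>\<^bsub>R\<^esub> PIdl z)"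
      proof (rule antimonoI)
        fix i j :: nat assume "i \<le> j"
        with step.prems(4) have "A j \<subseteq> A i" by (rule antimonoD)
        then show "A j <+>\<^bsub>R\<^esub> PIdl z \<subseteq> A i <+>\<^bsub>R\<^esub> PIdl z"
          by (force simp: mem_add_PIdl_iff)
      qed
    qed
    then obtain k where k: "\<And>j. j \<ge> k \<Longrightarrow> A j <+>\<^bsub>R\<^esub> PIdl z = A k <+>\<^bsub>R\<^esub> PIdl z" by blast
    \<comment> \<open>From index \<open>l\<close> on, membership of \<open>z\<close> in the chain is constant.\<close>
    obtain l where l: "(\<forall>j. z \<in> A j) \<or> z \<notin> A l" by blast
    have "A j = A (max k l)" if j: "j \<ge> max k l" for j
    proof
      interpret Aj: ideal "A j" R by (rule A)
      interpret Am: ideal "A (max k l)" R by (rule A)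
      show sub: "A j \<subseteq> A (max k l)" using step.prems(4) j by (rule antimonoD)
      show "A (max k l) \<subseteq> A j"
      proof
        fix t assume t: "t \<in> A (max k l)"
        have "A j <+>\<^bsub>R\<^esub> PIdl z = A (max k l) <+>\<^bsub>R\<^esub> PIdl z" using j by (intro trans[OF k k[symmetric]]) simp_all
        moreover have "t \<in> A (max k l) <+>\<^bsub>R\<^esub> PIdl z" using subset_add_PIdl[OF A zc] t by blast
        ultimately obtain u r where u: "u \<in> A j" and r: "r \<in> carrier R" and tu: "t = u \<oplus> r \<otimes> z"
          by (metis mem_add_PIdl_iff)
        have uc: "u \<in> carrier R" using u by (rule Aj.Icarr)
        have "r \<otimes> z \<in> A j"
        proof (cases "r \<in> N")
          case True
          then show ?thesis using Nz step.prems(3) by blast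
        next
          case False
          have "r \<otimes> z = t \<ominus> u" using uc r zc tu by algebra
          also have "\<dots> \<in> A (max k l)" using t u sub by (intro Am.diff_closed) auto
          finally have rz: "r \<otimes> z \<in> A (max k l)" .
          \<comment> \<open>As \<open>r\<close> is invertible modulo \<open>N\<close> and \<open>N z \<subseteq> C\<close>, the element \<open>z\<close> can be recovered from
            \<open>r z\<close>.\<close>
          have "N <+> PIdl r = carrier R"
          proof -
            have "N <+> PIdl r = N \<or> N <+> PIdl r = carrier R"
            proof (rule N.I_maximal)
              show "ideal (N <+> PIdl r) R" using N.is_ideal r by (rule add_PIdl_ideal)
              then show "N <+> PIdl r \<subseteq> carrier R"
                by (rule additive_subgroup.a_subset[OF ideal.axioms(1)])
              show "N \<subseteq> N <+> PIdl r" using N.is_ideal r by (rule subset_add_PIdl)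
            qed
            with self_mem_add_PIdl[OF N.is_ideal r] False show ?thesis by auto
          qed
          then obtain n c where n: "n \<in> N" and c: "c \<in> carrier R" and one: "\<one> = n \<oplus> c \<otimes> r"
            using one_closed mem_add_PIdl_iff[of \<one> N r] by auto
          have nc: "n \<in> carrier R" using n by (rule N.Icarr)
          have "z = (n \<oplus> c \<otimes> r) \<otimes> z" using zc by (simp add: one[symmetric])
          also have "\<dots> = n \<otimes> z \<oplus> c \<otimes> (r \<otimes> z)" using nc c r zc by algebra
          also have "\<dots> \<in> A (max k l)"
            using Nz[OF n] step.prems(3) Am.I_l_closed[OF rz c] by (intro Am.a_closed) auto
          finally have "z \<in> A (max k l)" .
          moreover have "A (max k l) \<subseteq> A l" using step.prems(4) by (rule antimonoD) simp
          ultimately have "z \<in> A j" using l by blast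
          then show ?thesis using r by (rule Aj.I_l_closed)
        qed
        then show "t \<in> A j" unfolding tu using u by (intro Aj.a_closed)
      qed
    qed
    then show ?thesis by blast
  qed
qed

context local_ring
begin

lemma max_ideal_maximal: "maximalideal (max_ideal R) R"
  unfolding max_ideal_def by (rule theI'[OF ex1_maximalideal])

lemma max_ideal_ideal: "ideal (max_ideal R) R"
  using max_ideal_maximal by (rule maximalideal.axioms)

lemma proper_ideal_subset_max_ideal:
  assumes "ideal I R" "I \<noteq> carrier R"
  shows "I \<subseteq> max_ideal R"
proof -
  let ?\<A> = "{J. ideal J R \<and> I \<subseteq> J \<and> J \<noteq> carrier R}"
  have "?\<A> \<noteq> {}" using assms by blast
  then have "\<exists>M\<in>?\<A>. \<forall>J\<in>?\<A>. M \<subseteq> J \<longrightarrow> J = M" by (rule exists_maximal_ideal_among) simp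
  then obtain M where "M \<in> ?\<A>" and max: "\<forall>J\<in>?\<A>. M \<subseteq> J \<longrightarrow> J = M" by (rule bexE)
  then have M: "ideal M R" "I \<subseteq> M" "M \<noteq> carrier R" by simp_all
  have "maximalideal M R"
  proof (rule maximalidealI)
    show "J = M \<or> J = carrier R" if "ideal J R" "M \<subseteq> J" for J
      using max M(2) that by blast
  qed (use M in auto)
  then have "M = max_ideal R" using max_ideal_maximal ex1_maximalideal by blast
  with M(2) show ?thesis by simp
qed

lemma one_minus_max_ideal_unit:
  assumes "y \<in> max_ideal R"
  shows "\<one> \<ominus> y \<in> Units R"
proof -
  interpret N: maximalideal "max_ideal R" R by (rule max_ideal_maximal)
  have yc: "y \<in> carrier R" using assms by (rule N.Icarr)
  have "PIdl (\<one> \<ominus> y) = carrier R"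
  proof (rule ccontr)
    assume "PIdl (\<one> \<ominus> y) \<noteq> carrier R"
    with yc have "PIdl (\<one> \<ominus> y) \<subseteq> max_ideal R"
      by (intro proper_ideal_subset_max_ideal cgenideal_ideal) auto
    then have "\<one> \<ominus> y \<in> max_ideal R" using cgenideal_self[of "\<one> \<ominus> y"] yc by auto
    then have "(\<one> \<ominus> y) \<oplus> y \<in> max_ideal R" using assms by (rule N.a_closed)
    moreover have "(\<one> \<ominus> y) \<oplus> y = \<one>" using yc by algebra
    ultimately show False using N.one_imp_carrier N.I_notcarr by simp
  qed
  then obtain c where "c \<in> carrier R" "\<one> = c \<otimes> (\<one> \<ominus> y)"
    using mem_PIdl_iff[of \<one> "\<one> \<ominus> y"] by auto
  with yc show ?thesis using m_comm[of c "\<one> \<ominus> y"] unfolding Units_def by force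
qed

text \<open>If \<open>B \<noteq> A\<close>, let \<open>C\<close> be maximal among the ideals with \<open>B \<subseteq> C \<subset> A\<close>.  Then \<open>A / C\<close> is simple, so
  that \<open>y A \<subseteq> C\<close> because \<open>y\<close> lies in the maximal ideal; hence \<open>A = B + y A \<subseteq> C\<close>, a contradiction.\<close>

lemma nakayama:
  assumes "ideal A R" "ideal B R" "B \<subseteq> A" "y \<in> max_ideal R"
    and decomp: "\<And>a. a \<in> A \<Longrightarrow> \<exists>b\<in>B. \<exists>c\<in>A. a = b \<oplus> y \<otimes> c"
  shows "A = B"
proof (rule ccontr)
  assume "A \<noteq> B"
  interpret N: ideal "max_ideal R" R by (rule max_ideal_ideal)
  interpret A: ideal A R by fact
  have yc: "y \<in> carrier R" using assms(4) by (rule N.Icarr)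
  let ?\<C> = "{C. ideal C R \<and> B \<subseteq> C \<and> C \<subset> A}"
  have "?\<C> \<noteq> {}" using assms(2,3) \<open>A \<noteq> B\<close> by blast
  then have "\<exists>M\<in>?\<C>. \<forall>J\<in>?\<C>. M \<subseteq> J \<longrightarrow> J = M" by (rule exists_maximal_ideal_among) simp
  then obtain C where "C \<in> ?\<C>" and max: "\<forall>D\<in>?\<C>. C \<subseteq> D \<longrightarrow> D = C" by (rule bexE)
  then have C: "ideal C R" "B \<subseteq> C" "C \<subset> A" by simp_all
  interpret C: ideal C R by (rule C(1))
  have yA: "y \<otimes> c \<in> C" if c: "c \<in> A" for c
  proof (rule ccontr)
    assume not: "y \<otimes> c \<notin> C"
    have cc: "c \<in> carrier R" using c by (rule A.Icarr)
    have ycc: "y \<otimes> c \<in> carrier R" using yc cc by simp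
    let ?D = "C <+>\<^bsub>R\<^esub> PIdl (y \<otimes> c)"
    have "?D \<subseteq> A"
    proof
      fix t assume "t \<in> ?D"
      then obtain d s where "d \<in> C" "s \<in> carrier R" "t = d \<oplus> s \<otimes> (y \<otimes> c)"
        unfolding mem_add_PIdl_iff by blast
      then show "t \<in> A" using C(3) c yc by (auto intro!: A.a_closed A.I_l_closed)
    qed
    moreover have "C \<subseteq> ?D" using C(1) ycc by (rule subset_add_PIdl)
    moreover have "?D \<noteq> C" using self_mem_add_PIdl[OF C(1) ycc] not by blast
    moreover have "ideal ?D R" using C(1) ycc by (rule add_PIdl_ideal)
    ultimately have "?D = A" using max C(2) by blast
    then obtain d s where d: "d \<in> C" and s: "s \<in> carrier R" and cd: "c = d \<oplus> s \<otimes> (y \<otimes> c)"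
      using c mem_add_PIdl_iff[of c C "y \<otimes> c"] by auto
    have dc: "d \<in> carrier R" using d by (rule C.Icarr)
    have unit: "\<one> \<ominus> s \<otimes> y \<in> Units R"
      using assms(4) s by (intro one_minus_max_ideal_unit N.I_l_closed)
    have "(\<one> \<ominus> s \<otimes> y) \<otimes> c = c \<ominus> s \<otimes> (y \<otimes> c)" using s yc cc by algebra
    also have "\<dots> = (d \<oplus> s \<otimes> (y \<otimes> c)) \<ominus> s \<otimes> (y \<otimes> c)" using cd by simp
    also have "\<dots> = d" using dc s yc cc by algebra
    finally have eq: "(\<one> \<ominus> s \<otimes> y) \<otimes> c = d" .
    have "c = (inv (\<one> \<ominus> s \<otimes> y) \<otimes> (\<one> \<ominus> s \<otimes> y)) \<otimes> c" using unit cc by simp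
    also have "\<dots> = inv (\<one> \<ominus> s \<otimes> y) \<otimes> d"
      using unit cc Units_inv_closed[OF unit] Units_closed[OF unit] by (simp only: m_assoc eq)
    also have "\<dots> \<in> C" using d Units_inv_closed[OF unit] by (rule C.I_l_closed)
    finally have "c \<in> C" .
    then show False using not yc C.I_l_closed by blast
  qed
  have "A \<subseteq> C"
  proof
    fix a assume "a \<in> A"
    then obtain b c where "b \<in> B" "c \<in> A" "a = b \<oplus> y \<otimes> c" using decomp by blast
    then show "a \<in> C" using yA C(2) by (auto intro: C.a_closed)
  qed
  with C(3) show False by blast
qed

end

section \<open>Noetherian local domains in which every nonzero ideal contains a power of one element\<close>

text \<open>The colon ideal \<open>(K : y\<^sup>\<infinity>)\<close>, that is, the contraction to \<open>R\<close> of the extension of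
  \<open>K\<close> to the localization \<open>R[1/y]\<close>.\<close>

lemma (in cring) elementwise_saturation_ideal:
  assumes "ideal K R" "y \<in> carrier R"
  shows "ideal {t \<in> carrier R. \<exists>i::nat. y [^] i \<otimes> t \<in> K} R"
proof -
  interpret K: ideal K R by fact
  have "\<exists>i::nat. y [^] i \<otimes> (t \<oplus> u) \<in> K"
    if "t \<in> carrier R" "u \<in> carrier R" "y [^] i \<otimes> t \<in> K" "y [^] j \<otimes> u \<in> K" for t u and i j :: nat
  proof
    have "y [^] (i + j) \<otimes> (t \<oplus> u) = y [^] j \<otimes> (y [^] i \<otimes> t) \<oplus> y [^] i \<otimes> (y [^] j \<otimes> u)"
      using that(1,2) assms(2) by (simp add: nat_pow_mult[symmetric] r_distr m_ac)
    also have "\<dots> \<in> K" using assms(2) by (intro K.a_closed K.I_l_closed that(3,4)) simp_all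
    finally show "y [^] (i + j) \<otimes> (t \<oplus> u) \<in> K" .
  qed
  moreover have "\<exists>i::nat. y [^] i \<otimes> (r \<otimes> t) \<in> K"
    if "t \<in> carrier R" "r \<in> carrier R" "y [^] i \<otimes> t \<in> K" for r t and i :: nat
  proof
    have "y [^] i \<otimes> (r \<otimes> t) = r \<otimes> (y [^] i \<otimes> t)" using that(1,2) assms(2) by (simp add: m_ac)
    then show "y [^] i \<otimes> (r \<otimes> t) \<in> K" using K.I_l_closed[OF that(3,2)] by simp
  qed
  ultimately show ?thesis
    using assms(2) K.zero_closed by (intro ideal_if_closed) auto
qed

lemma (in cring) ideal_power_mult_subset_PIdl_pow:
  assumes "ideal N R" "y \<in> carrier R" "ideal_power R N s \<subseteq> PIdl y"
  shows "ideal_power R N (s * i) \<subseteq> PIdl (y [^] i)"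
proof (induction i)
  case 0
  have "carrier R \<subseteq> PIdl \<one>" by (auto simp: mem_PIdl_iff)
  then show ?case using ideal_power_0 by auto
next
  case (Suc i)
  have "ideal_prod R (ideal_power R N s) (ideal_power R N (s * i)) \<subseteq> PIdl (y [^] Suc i)"
  proof (rule ideal_prod_subset)
    show "ideal (PIdl (y [^] Suc i)) R" using assms(2) by (intro cgenideal_ideal) simp
    fix a b assume "a \<in> ideal_power R N s" "b \<in> ideal_power R N (s * i)"
    then have "a \<in> PIdl y" "b \<in> PIdl (y [^] i)" using assms(3) Suc.IH by auto
    then obtain c d where "c \<in> carrier R" "a = c \<otimes> y" "d \<in> carrier R" "b = d \<otimes> y [^] i"
      unfolding mem_PIdl_iff by blast
    then have "a \<otimes> b = (c \<otimes> d) \<otimes> y [^] Suc i" "c \<otimes> d \<in> carrier R"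
      using assms(2) by (simp_all add: m_ac)
    then show "a \<otimes> b \<in> PIdl (y [^] Suc i)" unfolding mem_PIdl_iff by blast
  qed
  then show ?case using assms(1) by (simp only: mult_Suc_right ideal_power_add)
qed

text \<open>For \<open>x \<noteq> 0\<close> the quotient of \<open>(x\<^sup>k)\<close> by \<open>(x\<^sup>k\<^sup>+\<^sup>1)\<close> is isomorphic to \<open>R / (x)\<close> in a domain, so
  cancelling \<open>y\<close> modulo \<open>x\<^sup>k\<close> takes \<open>k\<close> rounds of cancelling it modulo \<open>x\<close>.\<close>

lemma (in domain) near_regularity_mod_power:
  assumes N: "ideal N R" and x: "x \<in> carrier R" "x \<noteq> \<zero>" and y: "y \<in> carrier R"
    and div: "\<And>t. t \<in> carrier R \<Longrightarrow> y \<otimes> t \<in> PIdl x \<Longrightarrow>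
      ideal_power R N e \<subseteq> ideal_colon R (PIdl x) {t}"
    and "t \<in> carrier R" "y \<otimes> t \<in> PIdl (x [^] k)"
  shows "ideal_power R N (k * e) \<subseteq> ideal_colon R (PIdl (x [^] k)) {t}"
  using assms(6,7)
proof (induction k arbitrary: t)
  case 0
  then show ?case
    unfolding mult_0 ideal_power_0 by (auto simp: mem_PIdl_iff)
next
  case (Suc k)
  have t: "t \<in> carrier R" by (rule Suc.prems(1))
  obtain c where c: "c \<in> carrier R" and yt: "y \<otimes> t = c \<otimes> (x [^] k \<otimes> x)"
    using Suc.prems(2) by (auto simp: mem_PIdl_iff)
  have "y \<otimes> t = (c \<otimes> x [^] k) \<otimes> x" "c \<otimes> x [^] k \<in> carrier R"
    using yt c x(1) by (simp_all add: m_assoc)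
  then have "y \<otimes> t \<in> PIdl x" unfolding mem_PIdl_iff by blast
  from div[OF t this] have sub: "ideal_power R N e \<subseteq> ideal_colon R (PIdl x) {t}" .
  show ?case
    unfolding mult_Suc ideal_power_add[OF N]
  proof (rule ideal_prod_subset)
    show "ideal (ideal_colon R (PIdl (x [^] Suc k)) {t}) R"
      using x(1) t by (intro ideal_colon_ideal cgenideal_ideal) auto
    fix z v assume z: "z \<in> ideal_power R N e" and v: "v \<in> ideal_power R N (k * e)"
    have zc: "z \<in> carrier R" using z sub by auto
    have vc: "v \<in> carrier R" using v ideal_power_ideal[OF N] by (rule ideal.Icarr[rotated])
    from z sub have "z \<otimes> t \<in> PIdl x" by auto
    then obtain u where u: "u \<in> carrier R" and zt: "z \<otimes> t = u \<otimes> x" unfolding mem_PIdl_iff by blast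
    have "(y \<otimes> u) \<otimes> x = (z \<otimes> (c \<otimes> x [^] k)) \<otimes> x"
    proof -
      have "(y \<otimes> u) \<otimes> x = y \<otimes> (z \<otimes> t)" using y u x(1) by (simp add: zt m_assoc)
      also have "\<dots> = z \<otimes> (y \<otimes> t)" using y zc t by (simp add: m_lcomm)
      also have "\<dots> = (z \<otimes> (c \<otimes> x [^] k)) \<otimes> x" using c x(1) zc by (simp add: yt m_assoc)
      finally show ?thesis .
    qed
    then have "y \<otimes> u = z \<otimes> (c \<otimes> x [^] k)"
      using m_rcancel[OF x(2,1), of "y \<otimes> u" "z \<otimes> (c \<otimes> x [^] k)"] y u zc c x(1) by simp
    also have "\<dots> = (z \<otimes> c) \<otimes> x [^] k" using zc c x(1) by (simp add: m_assoc)
    finally have "y \<otimes> u \<in> PIdl (x [^] k)" unfolding mem_PIdl_iff using zc c by blast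
    from Suc.IH[OF u this] v have "v \<otimes> u \<in> PIdl (x [^] k)" by auto
    then obtain d where d: "d \<in> carrier R" and vu: "v \<otimes> u = d \<otimes> x [^] k"
      unfolding mem_PIdl_iff by blast
    have "(z \<otimes> v) \<otimes> t = v \<otimes> (z \<otimes> t)" using zc vc t by (simp add: m_ac)
    also have "\<dots> = (v \<otimes> u) \<otimes> x" using vc u x(1) by (simp add: zt m_assoc)
    also have "\<dots> = d \<otimes> x [^] Suc k" using d x(1) by (simp add: vu m_assoc)
    finally have "(z \<otimes> v) \<otimes> t \<in> PIdl (x [^] Suc k)" unfolding mem_PIdl_iff using d by blast
    then show "z \<otimes> v \<in> ideal_colon R (PIdl (x [^] Suc k)) {t}" using zc vc by simp
  qed
qed

locale local_domain = local_ring + domain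

sublocale complete_local_domain \<subseteq> local_domain ..

context local_domain
begin

text \<open>With \<open>n\<close> the maximal ideal, take \<open>y \<in> n\<close> that can be cancelled modulo \<open>x\<close>, hence
  modulo all powers of \<open>x\<close>, up to a power of \<open>n\<close>.  The ideal \<open>(y)\<close> contains some \<open>x\<^sup>k = b y\<close>, and cancelling \<open>y\<close> in \<open>y b \<in> (x\<^sup>k)\<close>
  yields \<open>n\<^sup>s b \<subseteq> (x\<^sup>k) = (b y)\<close>, so \<open>n\<^sup>s \<subseteq> (y)\<close>.\<close>

lemma exists_elem_generating_primary_ideal:
  assumes x: "x \<in> carrier R" "x \<noteq> \<zero>"
    and radical: "\<And>Q. ideal Q R \<Longrightarrow> Q \<noteq> {\<zero>} \<Longrightarrow> \<exists>k::nat. x [^] k \<in> Q"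
    and not_sub: "\<And>e. \<not> ideal_power R (max_ideal R) e \<subseteq> PIdl x"
  shows "\<exists>y\<in>max_ideal R. \<exists>s. ideal_power R (max_ideal R) s \<subseteq> PIdl y"
proof -
  let ?N = "max_ideal R"
  interpret N: ideal ?N R by (rule max_ideal_ideal)
  obtain y e where y: "y \<in> ?N" and div: "\<And>t. t \<in> carrier R \<Longrightarrow> y \<otimes> t \<in> PIdl x \<Longrightarrow>
      ideal_power R ?N e \<subseteq> ideal_colon R (PIdl x) {t}"
    using exists_nearly_regular_element[OF cgenideal_ideal[OF x(1)] N.is_ideal] by blast
  have yc: "y \<in> carrier R" using y by (rule N.Icarr)
  \<comment> \<open>Otherwise \<open>y 1 = 0 \<in> (x)\<close>, and cancelling \<open>y\<close> would put a power of \<open>n\<close> into \<open>(x)\<close>.\<close>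
  have "y \<noteq> \<zero>"
  proof
    assume "y = \<zero>"
    moreover have "\<zero> \<in> PIdl x" 
      using cgenideal_ideal[OF x(1)] by (simp add: additive_subgroup.zero_closed ideal.axioms(1))
    ultimately have "ideal_power R ?N e \<subseteq> ideal_colon R (PIdl x) {\<one>}" using div[of \<one>] by simp
    moreover have "ideal_colon R (PIdl x) {\<one>} \<subseteq> PIdl x" by auto
    ultimately show False using not_sub by blast
  qed
  then have "PIdl y \<noteq> {\<zero>}" using cgenideal_self[OF yc] by auto
  from radical[OF cgenideal_ideal[OF yc] this] obtain k :: nat where "x [^] k \<in> PIdl y" by blast
  then obtain b where b: "b \<in> carrier R" and xk: "x [^] k = b \<otimes> y" unfolding mem_PIdl_iff by blast
  have xk0: "b \<noteq> \<zero>"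
  proof
    assume "b = \<zero>"
    then have "x [^] k = \<zero>" using xk yc by simp
    with x show False using nat_pow_nonzero by blast
  qed
  have "y \<otimes> b \<in> PIdl (x [^] k)"
    using cgenideal_self[of "x [^] k"] xk b x(1) yc by (simp add: m_comm)
  then have sub: "ideal_power R ?N (k * e) \<subseteq> ideal_colon R (PIdl (x [^] k)) {b}"
    using near_regularity_mod_power[OF N.is_ideal x yc div b] by blast
  have "ideal_power R ?N (k * e) \<subseteq> PIdl y"
  proof
    fix z assume "z \<in> ideal_power R ?N (k * e)"
    with sub have z: "z \<in> carrier R" "z \<otimes> b \<in> PIdl (x [^] k)" by auto
    then obtain c where c: "c \<in> carrier R" and "z \<otimes> b = c \<otimes> x [^] k" unfolding mem_PIdl_iff by blast
    then have "z \<otimes> b = (c \<otimes> y) \<otimes> b" using xk yc b by (simp add: m_ac)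
    then have "z = c \<otimes> y" using m_rcancel[OF xk0 b, of z "c \<otimes> y"] z(1) c yc by simp
    then show "z \<in> PIdl y" unfolding mem_PIdl_iff using c by blast
  qed
  with y show ?thesis by blast
qed

text \<open>The argument of Krull's principal ideal theorem.  With \<open>J j = ((x\<^sup>j) : y\<^sup>\<infinity>)\<close> the chain
  \<open>J j + (y)\<close> stabilises, since \<open>R / (y)\<close> is Artinian.  Because \<open>y\<close> can be cancelled modulo
  \<open>J k\<close>, equality of two consecutive terms means \<open>J k = J (k + 1) + y J k\<close>, so
  \<open>J k = J (k + 1)\<close> by Nakayama, and \<open>x\<^sup>k \<in> J (k + 1)\<close> gives the claim after division by \<open>x\<^sup>k\<close>.\<close>

lemma pow_mem_PIdl_if_max_ideal_power_subset_PIdl: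
  assumes x: "x \<in> carrier R" "x \<noteq> \<zero>" and y: "y \<in> max_ideal R"
    and s: "ideal_power R (max_ideal R) s \<subseteq> PIdl y"
  shows "\<exists>i::nat. y [^] i \<in> PIdl x"
proof -
  let ?N = "max_ideal R"
  interpret N: ideal ?N R by (rule max_ideal_ideal)
  have yc: "y \<in> carrier R" using y by (rule N.Icarr)
  define J where "J j = {t \<in> carrier R. \<exists>i::nat. y [^] i \<otimes> t \<in> PIdl (x [^] j)}" for j :: nat
  have J: "ideal (J j) R" for j
    unfolding J_def using x(1) yc by (intro elementwise_saturation_ideal cgenideal_ideal) auto
  have dec: "J (Suc j) \<subseteq> J j" for j
  proof -
    have "PIdl (x [^] Suc j) \<subseteq> PIdl (x [^] j)"
    proof (rule cgenideal_minimal)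
      show "ideal (PIdl (x [^] j)) R" using x(1) by (intro cgenideal_ideal) simp
      show "x [^] Suc j \<in> PIdl (x [^] j)" unfolding mem_PIdl_iff nat_pow_Suc2[OF x(1)] using x(1) by blast
    qed
    then show ?thesis unfolding J_def by blast
  qed
  let ?A = "\<lambda>j. J j <+>\<^bsub>R\<^esub> PIdl y"
  have "\<exists>k. \<forall>j\<ge>k. ?A j = ?A k"
  proof (rule descending_chain_stabilises)
    show "ideal (PIdl y) R" using yc by (rule cgenideal_ideal)
    show "maximalideal ?N R" by (rule max_ideal_maximal)
    show "ideal_power R ?N s \<subseteq> PIdl y" by (rule s)
    show A: "ideal (?A j) R" for j using J yc by (rule add_PIdl_ideal)
    show "PIdl y \<subseteq> ?A j" for j using A self_mem_add_PIdl[OF J yc] by (rule cgenideal_minimal)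
    show "antimono ?A"
    proof (rule decseq_SucI)
      show "?A (Suc j) \<subseteq> ?A j" for j using dec[of j] by (force simp: mem_add_PIdl_iff)
    qed
  qed
  then obtain k where k: "\<forall>j\<ge>k. ?A j = ?A k" by blast
  have Ak: "?A k = ?A (Suc k)" using k[rule_format, of "Suc k"] by simp
  interpret Jk: ideal "J k" R by (rule J)
  have "J k = J (Suc k)"
  proof (rule nakayama[OF J J dec y])
    fix t assume t: "t \<in> J k"
    then have "t \<in> ?A (Suc k)" using subset_add_PIdl[OF J yc, of k] Ak by auto
    then obtain u r where u: "u \<in> J (Suc k)" and r: "r \<in> carrier R" and tu: "t = u \<oplus> r \<otimes> y"
      unfolding mem_add_PIdl_iff by blast
    have uk: "u \<in> J k" using u dec by blast
    have "r \<otimes> y = t \<ominus> u" using tu r yc Jk.Icarr[OF uk] by algebra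
    also have "\<dots> \<in> J k" using t uk by (rule Jk.diff_closed)
    finally obtain i :: nat where "y [^] i \<otimes> (r \<otimes> y) \<in> PIdl (x [^] k)" unfolding J_def by blast
    then have "y [^] Suc i \<otimes> r \<in> PIdl (x [^] k)" using r yc by (simp add: m_ac)
    then have "r \<in> J k" unfolding J_def using r by blast
    moreover have "t = u \<oplus> y \<otimes> r" using tu r yc by (simp add: m_comm)
    ultimately show "\<exists>u\<in>J (Suc k). \<exists>r\<in>J k. t = u \<oplus> y \<otimes> r" using u by blast
  qed
  moreover have "x [^] k \<in> J k"
  proof -
    have "y [^] (0::nat) \<otimes> x [^] k \<in> PIdl (x [^] k)" using cgenideal_self[of "x [^] k"] x(1) by simp
    then show ?thesis unfolding J_def using x(1) by blast
  qed
  ultimately obtain i :: nat where "y [^] i \<otimes> x [^] k \<in> PIdl (x [^] Suc k)" unfolding J_def by blast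
  then obtain c where c: "c \<in> carrier R" and "y [^] i \<otimes> x [^] k = c \<otimes> x [^] Suc k"
    unfolding mem_PIdl_iff by blast
  then have "y [^] i \<otimes> x [^] k = (c \<otimes> x) \<otimes> x [^] k" using x(1) by (simp add: m_ac)
  moreover have "x [^] k \<noteq> \<zero>" using x nat_pow_nonzero by blast
  ultimately have "y [^] i = c \<otimes> x"
    using m_rcancel[of "x [^] k" "y [^] i" "c \<otimes> x"] c x(1) yc by simp
  then show ?thesis unfolding mem_PIdl_iff using c by blast
qed

text \<open>Let \<open>n\<close> be the maximal ideal.  All nonzero primes contain \<open>x\<close>.  If there were a prime
  strictly between \<open>0\<close> and \<open>n\<close>, then there would be infinitely many primes of height one, all
  minimal over \<open>x\<close>; this is the conceptual reason why no prime other than \<open>n\<close> contains \<open>x\<close>.  The proof below reaches the conclusion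
  directly: if \<open>(x)\<close> contained no power of \<open>n\<close>, some \<open>y \<in> n\<close> would satisfy \<open>n\<^sup>s \<subseteq> (y)\<close> and
  \<open>y\<^sup>i \<in> (x)\<close>, whence \<open>n\<^sup>s\<^sup>i \<subseteq> (y\<^sup>i) \<subseteq> (x)\<close>.\<close>

theorem max_ideal_power_subset_PIdl:
  assumes x: "x \<in> carrier R" "x \<noteq> \<zero>"
    and radical: "\<And>Q. ideal Q R \<Longrightarrow> Q \<noteq> {\<zero>} \<Longrightarrow> \<exists>k::nat. x [^] k \<in> Q"
  shows "\<exists>e. ideal_power R (max_ideal R) e \<subseteq> PIdl x"
proof (rule ccontr)
  assume no: "\<nexists>e. ideal_power R (max_ideal R) e \<subseteq> PIdl x"
  then obtain y s where y: "y \<in> max_ideal R" and s: "ideal_power R (max_ideal R) s \<subseteq> PIdl y"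
    using exists_elem_generating_primary_ideal[OF x radical] by blast
  have yc: "y \<in> carrier R" using max_ideal_ideal y by (rule ideal.Icarr)
  obtain i :: nat where "y [^] i \<in> PIdl x"
    using pow_mem_PIdl_if_max_ideal_power_subset_PIdl[OF x y s] by blast
  then have "PIdl (y [^] i) \<subseteq> PIdl x" using cgenideal_ideal[OF x(1)] by (intro cgenideal_minimal)
  with ideal_power_mult_subset_PIdl_pow[OF max_ideal_ideal yc s, of i] no show False by blast
qed

end

section \<open>Saturation in dimension one\<close>

lemma (in local_domain) saturation_zero:
  assumes "max_ideal R \<noteq> {\<zero>}"
  shows "saturation R {\<zero>} = {\<zero>}"
proof -
  interpret N: ideal "max_ideal R" R by (rule max_ideal_ideal)
  obtain m where m: "m \<in> max_ideal R" "m \<noteq> \<zero>" using assms N.zero_closed by blast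
  have mc: "m \<in> carrier R" using m(1) by (rule N.Icarr)
  have colon: "ideal_colon R {\<zero>} (ideal_power R (max_ideal R) i) = {\<zero>}" for i
  proof
    show "ideal_colon R {\<zero>} (ideal_power R (max_ideal R) i) \<subseteq> {\<zero>}"
    proof
      fix t assume "t \<in> ideal_colon R {\<zero>} (ideal_power R (max_ideal R) i)"
      then have "t \<in> carrier R" "t \<otimes> m [^] i = \<zero>"
        using pow_mem_ideal_power[OF m(1) N.is_ideal] by (auto simp: ideal_colon_def)
      moreover have "m [^] i \<noteq> \<zero>" using m(2) mc nat_pow_nonzero by blast
      ultimately show "t \<in> {\<zero>}" using mc integral[of t "m [^] i"] by auto
    qed
    show "{\<zero>} \<subseteq> ideal_colon R {\<zero>} (ideal_power R (max_ideal R) i)"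
      using ideal.Icarr[OF ideal_power_ideal[OF N.is_ideal]] by (auto simp: ideal_colon_def)
  qed
  show ?thesis unfolding saturation_def colon by auto
qed

lemma (in local_ring) saturation_eq_carrier:
  assumes "ideal I R" "ideal_power R (max_ideal R) e \<subseteq> I"
  shows "saturation R I = carrier R"
proof
  interpret I: ideal I R by fact
  \<comment> \<open>The union defining the saturation starts at the exponent \<open>1\<close>.\<close>
  have "ideal_power R (max_ideal R) (Suc e) \<subseteq> I"
    using ideal_prod_inter[OF ideal_power_ideal max_ideal_ideal] max_ideal_ideal assms(2)
    unfolding ideal_power_Suc by blast
  then have "carrier R \<subseteq> ideal_colon R I (ideal_power R (max_ideal R) (Suc e))"
    by (auto simp: ideal_colon_def intro: I.I_l_closed simp del: nat_pow_Suc)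
  then show "carrier R \<subseteq> saturation R I" unfolding saturation_def by fastforce
qed (auto simp: saturation_def ideal_colon_def)

context local_domain
begin

lemma
  assumes dim: "krull_dim R = 1"
  shows max_ideal_nonzero_if_dim_1: "max_ideal R \<noteq> {\<zero>}"
    and nonzero_prime_eq_max_ideal_if_dim_1:
      "\<And>P. primeideal P R \<Longrightarrow> P \<noteq> {\<zero>} \<Longrightarrow> P = max_ideal R"
proof -
  let ?chain = "\<lambda>n::nat. \<exists>P. (\<forall>i\<le>n. primeideal (P i) R) \<and> (\<forall>i<n. P i \<subset> P (Suc i))"
  have le: "n \<le> 1" if "?chain n" for n
  proof -
    have "enat n \<le> krull_dim R" unfolding krull_dim_def using that by (intro Sup_upper) blast
    then show ?thesis using dim by (simp add: one_enat_def)
  qed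
  have prime_le: "P \<subseteq> max_ideal R" if "primeideal P R" for P
    using that primeideal.I_notcarr primeideal.axioms(1) proper_ideal_subset_max_ideal by blast
  have zero_le: "{\<zero>} \<subseteq> P" if "primeideal P R" for P
    using that primeideal.axioms(1) ideal.axioms(1) additive_subgroup.zero_closed by blast
  show "max_ideal R \<noteq> {\<zero>}"
  proof
    assume zero: "max_ideal R = {\<zero>}"
    have "n = 0" if "?chain n" for n
    proof (rule ccontr)
      assume "n \<noteq> 0"
      with that obtain P where "primeideal (P 0) R" "primeideal (P 1) R" "P 0 \<subset> P (1::nat)"
        by (metis One_nat_def bot_nat_0.not_eq_extremum le0 Suc_leI)
      with prime_le[of "P 1"] zero_le[of "P 0"] zero show False by blast
    qed
    then have "{enat n | n. ?chain n} \<subseteq> {0}" by (auto simp: zero_enat_def)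
    then have "krull_dim R \<le> Sup {0}" unfolding krull_dim_def by (rule Sup_subset_mono)
    with dim show False by simp
  qed
  show "P = max_ideal R" if P: "primeideal P R" "P \<noteq> {\<zero>}" for P
  proof (rule ccontr)
    assume "P \<noteq> max_ideal R"
    \<comment> \<open>A prime strictly between \<open>0\<close> and the maximal ideal would give a chain of length two.\<close>
    let ?P = "\<lambda>i::nat. if i = 0 then {\<zero>} else if i = 1 then P else max_ideal R"
    have "{\<zero>} \<subset> P" "P \<subset> max_ideal R"
      using zero_le[OF P(1)] P(2) prime_le[OF P(1)] \<open>P \<noteq> max_ideal R\<close> by blast+
    then have "\<forall>i<2. ?P i \<subset> ?P (Suc i)" by (auto simp: less_2_cases_iff)
    moreover have "\<forall>i\<le>2. primeideal (?P i) R"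
      using P(1) zeroprimeideal maximalideal_prime[OF max_ideal_maximal] by auto
    ultimately have "?chain 2" by (intro exI[of _ ?P] conjI)
    with le[of 2] show False by simp
  qed
qed

end

section \<open>Saturation under the extension\<close>

theorem corollary1p6:
  fixes R :: "('a, 'r) ring_scheme" and S :: "('b, 's) ring_scheme" and h :: "'a \<Rightarrow> 'b"
  assumes "complete_local_domain R" and "complete_local_domain S"
    and "flat_extension R S h"
    and "krull_dim R = 1"
    and "\<And>Q. ideal Q S \<Longrightarrow> Q \<noteq> {\<zero>\<^bsub>S\<^esub>} \<Longrightarrow> ideal_contraction R h Q \<noteq> {\<zero>\<^bsub>R\<^esub>}"
  shows "\<forall>I. ideal I R \<longrightarrow>
    ideal_extension S h (saturation R I) = saturation S (ideal_extension S h I)"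
proof (intro allI impI)
  interpret R: complete_local_domain R by fact
  interpret S: complete_local_domain S by fact
  have ext: "h \<in> ring_hom R S" "inj_on h (carrier R)" "h ` max_ideal R \<subseteq> max_ideal S"
    using assms(3) by (simp_all add: flat_extension_def local_extension_def)
  interpret h: ring_hom_cring R S h
    by (intro ring_hom_cring.intro ring_hom_cring_axioms.intro R.cring_axioms S.cring_axioms ext(1))
  have h_nonzero: "h r \<noteq> \<zero>\<^bsub>S\<^esub>" if "r \<in> carrier R" "r \<noteq> \<zero>\<^bsub>R\<^esub>" for r
    using that inj_onD[OF ext(2), of r "\<zero>\<^bsub>R\<^esub>"] by auto
  let ?m = "max_ideal R" and ?n = "max_ideal S"
  interpret m: ideal ?m R by (rule R.max_ideal_ideal)
  obtain r where r: "r \<in> ?m" "r \<noteq> \<zero>\<^bsub>R\<^esub>"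
    using R.max_ideal_nonzero_if_dim_1[OF assms(4)] m.zero_closed by blast
  have rc: "r \<in> carrier R" using r(1) by (rule m.Icarr)
  have n_nonzero: "?n \<noteq> {\<zero>\<^bsub>S\<^esub>}" using h_nonzero[OF rc r(2)] ext(3) r(1) by blast
  have m_power: "\<exists>e. ideal_power R ?m e \<subseteq> K" if K: "ideal K R" "K \<noteq> {\<zero>\<^bsub>R\<^esub>}" for K
  proof (rule R.ideal_power_subset_if_all_primes_contain[OF K(1) m.is_ideal])
    fix P assume P: "primeideal P R" "K \<subseteq> P"
    have "\<zero>\<^bsub>R\<^esub> \<in> K" using K(1) by (simp add: additive_subgroup.zero_closed ideal.axioms(1))
    with K(2) P(2) have "P \<noteq> {\<zero>\<^bsub>R\<^esub>}" by blast
    with R.nonzero_prime_eq_max_ideal_if_dim_1[OF assms(4) P(1)] show "?m \<subseteq> P" by simp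
  qed
  have contraction: "ideal (ideal_contraction R h Q) R" if "ideal Q S" for Q
    unfolding ideal_contraction_def using that by (rule h.ring.ideal_vimage)
  fix I assume I: "ideal I R"
  interpret I: ideal I R by fact
  show "ideal_extension S h (saturation R I) = saturation S (ideal_extension S h I)"
  proof (cases "I = {\<zero>\<^bsub>R\<^esub>}")
    case True
    then show ?thesis
      using R.saturation_zero[OF R.max_ideal_nonzero_if_dim_1[OF assms(4)]] S.saturation_zero[OF n_nonzero]
      by (simp add: ideal_extension_def S.genideal_zero)
  next
    case False
    from m_power[OF I False] obtain e where e: "ideal_power R ?m e \<subseteq> I" by blast
    \<comment> \<open>The exponent \<open>e + 1\<close> instead of \<open>e\<close> ensures that \<open>x\<close> lies in the maximal ideal also when
      \<open>e = 0\<close>.\<close>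
    define x where "x = r [^]\<^bsub>R\<^esub> Suc e"
    have xc: "x \<in> carrier R" using rc by (simp add: x_def)
    have "r [^]\<^bsub>R\<^esub> e \<in> I" using R.pow_mem_ideal_power[OF r(1) m.is_ideal] e by blast
    then have xI: "x \<in> I" unfolding x_def using rc by (simp add: I.I_r_closed)
    have xm: "x \<in> ?m" unfolding x_def using rc r(1) by (simp add: m.I_l_closed)
    have x0: "x \<noteq> \<zero>\<^bsub>R\<^esub>" unfolding x_def using rc r(2) R.nat_pow_nonzero by blast
    have "\<exists>f. ideal_power S ?n f \<subseteq> PIdl\<^bsub>S\<^esub> (h x)"
    proof (rule S.max_ideal_power_subset_PIdl)
      show "h x \<in> carrier S" using xc by simp
      show "h x \<noteq> \<zero>\<^bsub>S\<^esub>" using xc x0 by (rule h_nonzero)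
      fix Q assume Q: "ideal Q S" "Q \<noteq> {\<zero>\<^bsub>S\<^esub>}"
      from m_power[OF contraction[OF Q(1)] assms(5)[OF Q]] obtain k
        where "ideal_power R ?m k \<subseteq> ideal_contraction R h Q" by blast
      then have "x [^]\<^bsub>R\<^esub> k \<in> ideal_contraction R h Q"
        using R.pow_mem_ideal_power[OF xm m.is_ideal] by blast
      then have "h x [^]\<^bsub>S\<^esub> k \<in> Q" using xc by (simp add: ideal_contraction_def h.ring.hom_nat_pow)
      then show "\<exists>k::nat. h x [^]\<^bsub>S\<^esub> k \<in> Q" by blast
    qed
    then obtain f where f: "ideal_power S ?n f \<subseteq> PIdl\<^bsub>S\<^esub> (h x)" by blast
    have hI: "h ` I \<subseteq> carrier S" using I.Icarr by auto
    have ideal_ext: "ideal (ideal_extension S h I) S"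
      unfolding ideal_extension_def using hI by (rule S.genideal_ideal)
    have "h x \<in> ideal_extension S h I"
      unfolding ideal_extension_def using S.genideal_self[OF hI] xI by blast
    then have "PIdl\<^bsub>S\<^esub> (h x) \<subseteq> ideal_extension S h I" using ideal_ext by (intro S.cgenideal_minimal)
    with f have "ideal_power S ?n f \<subseteq> ideal_extension S h I" by blast
    with ideal_ext have satS: "saturation S (ideal_extension S h I) = carrier S"
      by (rule S.saturation_eq_carrier)
    have hR: "h ` carrier R \<subseteq> carrier S" by auto
    have "\<one>\<^bsub>S\<^esub> \<in> ideal_extension S h (carrier R)"
      unfolding ideal_extension_def using S.genideal_self[OF hR] h.hom_one R.one_closed
      by (metis image_eqI subsetD)
    moreover have "ideal (ideal_extension S h (carrier R)) S"
      unfolding ideal_extension_def using hR by (rule S.genideal_ideal)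
    ultimately have "ideal_extension S h (carrier R) = carrier S"
      by (intro ideal.one_imp_carrier)
    with satS R.saturation_eq_carrier[OF I e] show ?thesis by simp
  qed
qed

end
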